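(* Let $n\geq2$ and let $(W,S)$ be the Coxeter system of type $\widetilde A_n$, with $S=\{s_0,s_1,\ldots,s_n\}$, where $s_is_{i+1}$ ($0\le i\le n-1$) and $s_ns_0$ have order $3$ and all other products of two distinct elements of $S$ have order $2$. Let $D=(V,V^\vee,(-,-),\Pi,\Pi^\vee,\iota)$ be a realized root system datum of $(W,S)$, with $\Pi=\{\alpha_0,\ldots,\alpha_n\}$ and $\alpha_i$ the simple root corresponding to $s_i$. Then $\Pi$ and $\Pi^\vee$ are linearly independent, and there is a unique positive real number $v$ such that $D$ can be rescaled to a realized root system datum with simple roots $\alpha_0,\dots,\alpha_n$ (denoted by the same symbols after rescaling) satisfying $$(\alpha_0,\alpha_1^\vee)=-v,\quad(\alpha_1,\alpha_0^\vee)=-\tfrac1v,\quad (\alpha_n,\alpha_0^\vee)=-v,\quad(\alpha_0,\alpha_n^\vee)=-\tfrac1v,$$ $$(\alpha_i,\alpha_{i+1}^\vee)=(\alpha_{i+1},\alpha_i^\vee)=-1\ (1\le i\le n-1),\quad (\alpha_i,\alpha_i^\vee)=2\ (0\le i\le n),$$ and $(\alpha_i,\alpha_j^\vee)=0$ otherwise.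
   Context: A subset $\Gamma$ of a real vector space is positively independent if there are no $n\ge 1$, pairwise distinct $\gamma_1,\dots,\gamma_n\in\Gamma$ and $c_1,\dots,c_n>0$ with $\sum c_i\gamma_i=0$. A realized root system datum is $D=(V,V^\vee,(-,-),\Pi,\Pi^\vee,\iota)$ where: $V,V^\vee$ are real vector spaces with positively independent subsets $\Pi\subseteq V$, $\Pi^\vee\subseteq V^\vee$; $\iota:\Pi\to\Pi^\vee$, $\alpha\mapsto\alpha^\vee$, is a bijection; $(-,-):V\times V^\vee\to\mathbb{R}$ is bilinear with $(\alpha,\alpha^\vee)=2$ for $\alpha\in\Pi$; and for all $\alpha\ne\beta$ in $\Pi$: $(\alpha,\beta^\vee)\le 0$, $(\alpha,\beta^\vee)=0$ iff $(\beta,\alpha^\vee)=0$, and $(\alpha,\beta^\vee)(\beta,\alpha^\vee)\in\{4\cos^2\frac{\pi}{m}\mid m\in\mathbb{N},m\ge 2\}\cup[4,\infty)$. It is assumed that $\Pi$ spans $V$ and $\Pi^\vee$ spans $V^\vee$. For $\alpha\in\Pi$ let $s_\alpha:V\to V$, $u\mapsto u-(u,\alpha^\vee)\alpha$. Then $\widehat S=\{s_\alpha\mid\alpha\in\Pi\}$ and the group $\widehat W$ it generates form a Coxeter system ($\alpha\mapsto s_\alpha$ being injective), in which $s_\alpha s_\beta$ ($\alpha\neq\beta$) has order $m$ if $(\alpha,\beta^\vee)(\beta,\alpha^\vee)=4\cos^2\frac{\pi}{m}$ and infinite order if this product is $\ge4$. A realized root system datum of $(W,S)$ is such a $D$ together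 with an isomorphism of Coxeter systems $(W,S)\cong(\widehat W,\widehat S)$ (a group isomorphism restricting to a bijection $S\to\widehat S$), regarded as an identification. Rescaling $D$ means replacing $\Pi$ by $\{d_\alpha\alpha\mid\alpha\in\Pi\}$, $\Pi^\vee$ by $\{d_\alpha^{-1}\alpha^\vee\mid\alpha\in\Pi\}$ and $\iota$ by $d_\alpha\alpha\mapsto d_\alpha^{-1}\alpha^\vee$, for some family of positive real numbers $d_\alpha$ ($\alpha\in\Pi$). *)

theory Defs
  imports "HOL-Analysis.Analysis" "HOL-Algebra.Bij" "HOL-Algebra.Multiplicative_Group"
    "HOL-Algebra.Generated_Groups"
begin

text \<open>
  \<open>(W,S)\<close> is a Coxeter system if \<open>W\<close> is presented by the involutions in \<open>S\<close> subject to
  \<open>(st)\<^bsup>m(s,t)\<^esup> = 1\<close> whenever the order \<open>m(s,t)\<close> of \<open>st\<close> is finite. The presentation is given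
  on words over \<open>S\<close>: every word representing the identity reduces to the empty word by inserting
  and deleting the relators. No formal inverses of generators are needed, because the case
  \<open>s = t\<close> supplies the relator \<open>ss\<close>; and as \<open>group.ord\<close> is \<open>0\<close> on elements of infinite order, the
  relator is then the empty word, i.e. no relation is imposed.
\<close>

definition word_val :: "('g, 'x) monoid_scheme \<Rightarrow> 'g list \<Rightarrow> 'g" where
  "word_val W w = foldr (mult W) w \<one>\<^bsub>W\<^esub>"

definition coxeter_relator :: "('g, 'x) monoid_scheme \<Rightarrow> 'g \<Rightarrow> 'g \<Rightarrow> 'g list" where
  "coxeter_relator W s t = concat (replicate (group.ord W (s \<otimes>\<^bsub>W\<^esub> t)) [s, t])"

definition coxeter_insertions :: "('g, 'x) monoid_scheme \<Rightarrow> 'g set \<Rightarrow> ('g list \<times> 'g list) set" where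
  "coxeter_insertions W S =
     {(u @ v, u @ coxeter_relator W s t @ v) | u v s t.
        u \<in> lists S \<and> v \<in> lists S \<and> s \<in> S \<and> t \<in> S}"

definition coxeter_system :: "('g, 'x) monoid_scheme \<Rightarrow> 'g set \<Rightarrow> bool" where
  "coxeter_system W S \<longleftrightarrow>
     group W \<and> S \<subseteq> carrier W \<and> generate W S = carrier W \<and>
     (\<forall>s\<in>S. group.ord W s = 2) \<and>
     (\<forall>w\<in>lists S. word_val W w = \<one>\<^bsub>W\<^esub> \<longrightarrow>
        (w, []) \<in> (coxeter_insertions W S \<union> (coxeter_insertions W S)\<inverse>)\<^sup>*)"

definition cyclic_adjacent :: "nat \<Rightarrow> nat \<Rightarrow> nat \<Rightarrow> bool" where
  "cyclic_adjacent n i j \<longleftrightarrow>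
     j = i + 1 \<or> i = j + 1 \<or> (i = n \<and> j = 0) \<or> (i = 0 \<and> j = n)"

definition affine_A_system :: "nat \<Rightarrow> ('g, 'x) monoid_scheme \<Rightarrow> (nat \<Rightarrow> 'g) \<Rightarrow> bool" where
  "affine_A_system n W s \<longleftrightarrow>
     inj_on s {0..n} \<and> coxeter_system W (s ` {0..n}) \<and>
     (\<forall>i\<le>n. \<forall>j\<le>n. i \<noteq> j \<longrightarrow>
        group.ord W (s i \<otimes>\<^bsub>W\<^esub> s j) = (if cyclic_adjacent n i j then 3 else 2))"

definition positively_independent :: "'v::real_vector set \<Rightarrow> bool" where
  "positively_independent \<Gamma> \<longleftrightarrow>
     \<not> (\<exists>F c. finite F \<and> F \<noteq> {} \<and> F \<subseteq> \<Gamma> \<and> (\<forall>\<gamma>\<in>F. c \<gamma> > 0) \<and> (\<Sum>\<gamma>\<in>F. c \<gamma> *\<^sub>R \<gamma>) = 0)"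

text \<open>The spaces \<open>V\<close> and \<open>V\<^sup>\<or>\<close> are the types \<open>'v\<close> and \<open>'w\<close>; only the values of \<open>coroot\<close> on the
  simple roots are meaningful.\<close>

record ('v, 'w) root_datum =
  pairing :: "'v \<Rightarrow> 'w \<Rightarrow> real"
  simple_roots :: "'v set"
  simple_coroots :: "'w set"
  coroot :: "'v \<Rightarrow> 'w"

definition realized_root_datum :: "('v::real_vector, 'w::real_vector) root_datum \<Rightarrow> bool" where
  "realized_root_datum D \<longleftrightarrow>
     (let R = simple_roots D; a = (\<lambda>\<alpha> \<beta>. pairing D \<alpha> (coroot D \<beta>)) in
       bilinear (pairing D) \<and>
       positively_independent R \<and> positively_independent (simple_coroots D) \<and>
       span R = UNIV \<and> span (simple_coroots D) = UNIV \<and>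
       bij_betw (coroot D) R (simple_coroots D) \<and>
       (\<forall>\<alpha>\<in>R. a \<alpha> \<alpha> = 2) \<and>
       (\<forall>\<alpha>\<in>R. \<forall>\<beta>\<in>R. \<alpha> \<noteq> \<beta> \<longrightarrow>
          a \<alpha> \<beta> \<le> 0 \<and> (a \<alpha> \<beta> = 0 \<longleftrightarrow> a \<beta> \<alpha> = 0) \<and>
          a \<alpha> \<beta> * a \<beta> \<alpha> \<in> {4 * (cos (pi / real m))\<^sup>2 | m :: nat. m \<ge> 2} \<union> {4..}))"

definition simple_reflection ::
    "('v::real_vector, 'w::real_vector) root_datum \<Rightarrow> 'v \<Rightarrow> 'v \<Rightarrow> 'v" where
  "simple_reflection D \<alpha> = (\<lambda>u. u - pairing D u (coroot D \<alpha>) *\<^sub>R \<alpha>)"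

definition simple_reflections :: "('v::real_vector, 'w::real_vector) root_datum \<Rightarrow> ('v \<Rightarrow> 'v) set" where
  "simple_reflections D = simple_reflection D ` simple_roots D"

definition reflection_group :: "('v::real_vector, 'w::real_vector) root_datum \<Rightarrow> ('v \<Rightarrow> 'v) monoid" where
  "reflection_group D = subgroup_generated (BijGroup UNIV) (simple_reflections D)"

definition realized_root_datum_of ::
    "('g, 'x) monoid_scheme \<Rightarrow> 'g set \<Rightarrow> ('g \<Rightarrow> 'v \<Rightarrow> 'v) \<Rightarrow>
     ('v::real_vector, 'w::real_vector) root_datum \<Rightarrow> bool" where
  "realized_root_datum_of W S \<phi> D \<longleftrightarrow>
     realized_root_datum D \<and> \<phi> \<in> iso W (reflection_group D) \<and> bij_betw \<phi> S (simple_reflections D)"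

text \<open>\<open>\<alpha> 0, \<dots>, \<alpha> n\<close> are the simple roots of \<open>D\<close>, with \<open>\<alpha> i\<close> corresponding to the generator
  \<open>s i\<close> under the identification \<open>\<phi>\<close>.\<close>

definition simple_roots_labelled ::
    "nat \<Rightarrow> (nat \<Rightarrow> 'g) \<Rightarrow> ('g \<Rightarrow> 'v \<Rightarrow> 'v) \<Rightarrow>
     ('v::real_vector, 'w::real_vector) root_datum \<Rightarrow> (nat \<Rightarrow> 'v) \<Rightarrow> bool" where
  "simple_roots_labelled n s \<phi> D \<alpha> \<longleftrightarrow>
     simple_roots D = \<alpha> ` {0..n} \<and> (\<forall>i\<le>n. \<phi> (s i) = simple_reflection D (\<alpha> i))"

definition is_rescaling ::
    "('v::real_vector, 'w::real_vector) root_datum \<Rightarrow> ('v \<Rightarrow> real) \<Rightarrow> ('v, 'w) root_datum \<Rightarrow> bool" where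
  "is_rescaling D d D' \<longleftrightarrow>
     (\<forall>\<alpha>\<in>simple_roots D. d \<alpha> > 0) \<and>
     pairing D' = pairing D \<and>
     simple_roots D' = (\<lambda>\<alpha>. d \<alpha> *\<^sub>R \<alpha>) ` simple_roots D \<and>
     simple_coroots D' = (\<lambda>\<alpha>. inverse (d \<alpha>) *\<^sub>R coroot D \<alpha>) ` simple_roots D \<and>
     (\<forall>\<alpha>\<in>simple_roots D. coroot D' (d \<alpha> *\<^sub>R \<alpha>) = inverse (d \<alpha>) *\<^sub>R coroot D \<alpha>)"

end

theory Submission
  imports Defs
begin

text \<open>
  The order of \<open>s\<^sub>i s\<^sub>j\<close> determines \<open>a\<^sub>i\<^sub>j a\<^sub>j\<^sub>i\<close>, where \<open>a\<^sub>i\<^sub>j = (\<alpha>\<^sub>i, \<alpha>\<^sub>j\<^sup>\<or>)\<close>: evaluating the braid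
  relation on a simple root and using positive independence gives \<open>a\<^sub>i\<^sub>j = a\<^sub>j\<^sub>i = 0\<close> for order 2 and
  \<open>a\<^sub>i\<^sub>j a\<^sub>j\<^sub>i = 1\<close> for order 3. Rescaling makes the entries along the path \<open>1, \<dots>, n\<close> equal to
  \<open>-1\<close>, and the scale of \<open>\<alpha>\<^sub>0\<close> then balances the two remaining edges; \<open>v\<^sup>2\<close> is the product of the
  \<open>-a\<^sub>i\<^sub>j\<close> around the cycle, which no rescaling changes. For the normalized matrix a kernel vector is,
  after weighting its entry at 0, an arithmetic progression that returns to a multiple of its first
  term, hence constant. A constant kernel vector is excluded by positive independence, which
  gives linear independence.
\<close>

section \<open>Positive and linear independence under indexing and scaling\<close>

text \<open>The second coefficient will be the negative of a pairing, known only to be nonpositive,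
  so it may vanish; the forbidden positive combination is then supported on \<open>x\<close>
  alone.\<close>

lemma positively_independent_pair:
  assumes "positively_independent R" "x \<in> R" "y \<in> R" "x \<noteq> y" "c > 0" "e \<ge> 0"
  shows "c *\<^sub>R x + e *\<^sub>R y \<noteq> 0"
proof
  assume eq: "c *\<^sub>R x + e *\<^sub>R y = 0"
  define F where "F = (if e = 0 then {x} else {x, y})"
  define w where "w = (\<lambda>z. if z = x then c else e)"
  have "finite F" "F \<noteq> {}" "F \<subseteq> R" "\<forall>z\<in>F. w z > 0"
    using assms by (auto simp: F_def w_def)
  moreover have "(\<Sum>z\<in>F. w z *\<^sub>R z) = 0"
    using eq \<open>x \<noteq> y\<close> by (auto simp: F_def w_def)
  ultimately show False
    using \<open>positively_independent R\<close> unfolding positively_independent_def by blast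
qed

lemma positively_independent_image_sum:
  assumes "positively_independent (f ` I)" "inj_on f I" "finite I" "I \<noteq> {}"
    and "\<And>i. i \<in> I \<Longrightarrow> c i > 0"
  shows "(\<Sum>i\<in>I. c i *\<^sub>R f i) \<noteq> 0"
proof
  assume eq: "(\<Sum>i\<in>I. c i *\<^sub>R f i) = 0"
  have "(\<Sum>x\<in>f ` I. c (inv_into I f x) *\<^sub>R x) = 0"
    using eq assms(2) by (simp add: sum.reindex)
  moreover have "\<forall>x\<in>f ` I. c (inv_into I f x) > 0"
    using assms(2,5) by auto
  moreover have "finite (f ` I)" "f ` I \<noteq> {}"
    using assms(3,4) by auto
  ultimately have "\<not> positively_independent (f ` I)"
    unfolding positively_independent_def not_not
    by (intro exI[of _ "f ` I"] exI[of _ "\<lambda>x. c (inv_into I f x)"]) auto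
  then show False
    using assms(1) by simp
qed

lemma independent_image_finite:
  assumes "finite I" "inj_on f I"
    and "\<And>c i. (\<Sum>i\<in>I. c i *\<^sub>R f i) = 0 \<Longrightarrow> i \<in> I \<Longrightarrow> c i = 0"
  shows "independent (f ` I)"
  unfolding independent_explicit_finite_subsets
proof (intro allI impI ballI)
  fix A u y
  assume A: "A \<subseteq> f ` I" "finite A" "(\<Sum>x\<in>A. u x *\<^sub>R x) = 0" and "y \<in> A"
  have "(\<Sum>i\<in>I. (if f i \<in> A then u (f i) else 0) *\<^sub>R f i) =
      (\<Sum>x\<in>f ` I. (if x \<in> A then u x else 0) *\<^sub>R x)"
    using assms(2) by (simp add: sum.reindex)
  also have "\<dots> = (\<Sum>x\<in>A. u x *\<^sub>R x)"
    using A(1) assms(1) by (intro sum.mono_neutral_cong_right) auto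
  finally have "(\<Sum>i\<in>I. (if f i \<in> A then u (f i) else 0) *\<^sub>R f i) = 0"
    using A(3) by simp
  then have "i \<in> I \<Longrightarrow> (if f i \<in> A then u (f i) else 0) = 0" for i
    by (rule assms(3))
  then show "u y = 0"
    using \<open>y \<in> A\<close> A(1) by (metis imageE subsetD)
qed

text \<open>Two roots merged by the scaling would be proportional. Positive independence would not
  exclude this, since it allows both a vector and its double in the set.\<close>

lemma independent_scale_image:
  assumes "independent R" "\<And>x. x \<in> R \<Longrightarrow> d x \<noteq> 0"
  shows "inj_on (\<lambda>x. d x *\<^sub>R x) R"
proof (rule inj_onI, rule ccontr)
  fix x y assume xy: "x \<in> R" "y \<in> R" "d x *\<^sub>R x = d y *\<^sub>R y" "x \<noteq> y"
  have "(d y / d x) *\<^sub>R y = inverse (d x) *\<^sub>R (d y *\<^sub>R y)"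
    by (simp add: field_simps)
  also have "\<dots> = x"
    using xy(1) assms(2) by (simp flip: xy(3))
  finally have "x \<in> span (R - {x})"
    using xy by (metis Diff_iff singletonD span_base span_scale)
  then show False
    using assms(1) xy(1) dependent_def by blast
qed

lemma positively_independent_scale:
  assumes "positively_independent R" "\<And>x. x \<in> R \<Longrightarrow> d x > 0" "inj_on (\<lambda>x. d x *\<^sub>R x) R"
  shows "positively_independent ((\<lambda>x. d x *\<^sub>R x) ` R)"
  unfolding positively_independent_def
proof
  assume "\<exists>F c. finite F \<and> F \<noteq> {} \<and> F \<subseteq> (\<lambda>x. d x *\<^sub>R x) ` R \<and> (\<forall>\<gamma>\<in>F. c \<gamma> > 0) \<and>
    (\<Sum>\<gamma>\<in>F. c \<gamma> *\<^sub>R \<gamma>) = 0"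
  then obtain F c where F: "finite F" "F \<noteq> {}" "F \<subseteq> (\<lambda>x. d x *\<^sub>R x) ` R" "\<forall>\<gamma>\<in>F. c \<gamma> > 0"
    "(\<Sum>\<gamma>\<in>F. c \<gamma> *\<^sub>R \<gamma>) = 0"
    by blast
  then obtain G where G: "G \<subseteq> R" "finite G" "F = (\<lambda>x. d x *\<^sub>R x) ` G"
    using finite_subset_image[OF F(1,3)] by blast
  have "G \<noteq> {}" "\<forall>x\<in>G. c (d x *\<^sub>R x) * d x > 0"
    using F(2,4) G assms(2) by auto
  moreover have "(\<Sum>x\<in>G. (c (d x *\<^sub>R x) * d x) *\<^sub>R x) = 0"
    using F(5) G inj_on_subset[OF assms(3) G(1)] by (simp add: sum.reindex)
  ultimately have "\<not> positively_independent R"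
    unfolding positively_independent_def not_not
    using G(1,2) by (intro exI[of _ G] exI[of _ "\<lambda>x. c (d x *\<^sub>R x) * d x"]) auto
  then show False
    using assms(1) by simp
qed

section \<open>Cyclic matrices\<close>

text \<open>The conditions on the entries in the theorem, stated for an arbitrary matrix so that
  they can be applied to roots and, after transposition, to coroots.\<close>

definition cyclic_normal_form :: "nat \<Rightarrow> real \<Rightarrow> (nat \<Rightarrow> nat \<Rightarrow> real) \<Rightarrow> bool" where
  "cyclic_normal_form n v a \<longleftrightarrow>
     a 0 1 = - v \<and> a 1 0 = - 1 / v \<and> a n 0 = - v \<and> a 0 n = - 1 / v \<and>
     (\<forall>i. 1 \<le> i \<and> i \<le> n - 1 \<longrightarrow> a i (i + 1) = - 1 \<and> a (i + 1) i = - 1) \<and>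
     (\<forall>i\<le>n. a i i = 2) \<and>
     (\<forall>i\<le>n. \<forall>j\<le>n. i \<noteq> j \<and> \<not> cyclic_adjacent n i j \<longrightarrow> a i j = 0)"

lemma cyclic_adjacent_sym: "cyclic_adjacent n i j \<longleftrightarrow> cyclic_adjacent n j i"
  by (auto simp: cyclic_adjacent_def)

lemma cyclic_normal_form_cong:
  assumes "n \<ge> 2" "\<And>i j. i \<le> n \<Longrightarrow> j \<le> n \<Longrightarrow> b i j = a i j" "cyclic_normal_form n v a"
  shows "cyclic_normal_form n v b"
  using assms by (auto simp: cyclic_normal_form_def)

lemma cyclic_normal_form_transpose:
  assumes "cyclic_normal_form n v a"
  shows "cyclic_normal_form n (1 / v) (\<lambda>i j. a j i)"
  using assms cyclic_adjacent_sym[of n] unfolding cyclic_normal_form_def by auto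

text \<open>Meant for the columns of a cyclic matrix, where only the diagonal entry and its two
  neighbours survive; the three indices are distinct when \<open>n \<ge> 2\<close>.\<close>

lemma sum_three_terms:
  fixes f :: "nat \<Rightarrow> real"
  assumes "i \<le> n" "j \<le> n" "k \<le> n" "i \<noteq> j" "j \<noteq> k" "i \<noteq> k"
    and "\<And>l. l \<le> n \<Longrightarrow> l \<noteq> i \<Longrightarrow> l \<noteq> j \<Longrightarrow> l \<noteq> k \<Longrightarrow> f l = 0"
  shows "(\<Sum>l\<le>n. f l) = f i + f j + f k"
proof -
  have "(\<Sum>l\<le>n. f l) = (\<Sum>l\<in>{i, j, k}. f l)"
    using assms by (intro sum.mono_neutral_right) auto
  then show ?thesis
    using assms(4-6) by simp
qed

text \<open>The kernel is taken on the left because rows belong to roots: a linear relation among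
  the roots yields such an \<open>x\<close>. For \<open>v = 1\<close> the constant vectors are the
  null direction of the affine Cartan matrix; for other \<open>v\<close> the argument gives
  \<open>x 0 = 0\<close>, so the kernel is trivial.\<close>

lemma cyclic_normal_form_kernel:
  assumes a: "cyclic_normal_form n v a" and "v > 0" and "n \<ge> 2"
    and ker: "\<And>j. j \<le> n \<Longrightarrow> (\<Sum>i\<le>n. x i * a i j) = 0"
    and "i \<le> n"
  shows "x i = x 0"
proof -
  have edge: "a 0 1 = - v" "a 1 0 = - 1 / v" "a n 0 = - v" "a 0 n = - 1 / v"
    and path: "\<And>i. 1 \<le> i \<Longrightarrow> i < n \<Longrightarrow> a i (Suc i) = - 1 \<and> a (Suc i) i = - 1"
    and diag: "\<And>i. i \<le> n \<Longrightarrow> a i i = 2"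
    and zero: "\<And>i j. i \<le> n \<Longrightarrow> j \<le> n \<Longrightarrow> i \<noteq> j \<Longrightarrow> \<not> cyclic_adjacent n i j \<Longrightarrow> a i j = 0"
    using a by (auto simp: cyclic_normal_form_def)
  \<comment> \<open>The cycle is unrolled to the indices \<open>0\<close> to \<open>n + 1\<close>,
    with vertex 0 at both ends. The weights \<open>v\<close> and \<open>1 / v\<close> absorb the
    entries \<open>a 0 1\<close> and \<open>a 0 n\<close>, so that columns \<open>1\<close> to
    \<open>n\<close> say that the second differences of \<open>y\<close> vanish.\<close>
  define y where "y j = (if j = 0 then v * x 0 else if j = Suc n then x 0 / v else x j)" for j
  have step: "y (Suc (Suc j)) - y (Suc j) = y (Suc j) - y j" if "j < n" for j
  proof -
    \<comment> \<open>The successor of \<open>Suc j\<close> on the cycle, which wraps around to 0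
      after \<open>n\<close>.\<close>
    define k where "k = (if Suc j = n then 0 else Suc (Suc j))"
    have "(\<Sum>l\<le>n. x l * a l (Suc j)) =
        x j * a j (Suc j) + x (Suc j) * a (Suc j) (Suc j) + x k * a k (Suc j)"
      using that \<open>n \<ge> 2\<close>
      by (intro sum_three_terms) (auto simp: k_def cyclic_adjacent_def intro!: zero split: if_splits)
    moreover have "x j * a j (Suc j) = - y j"
      using that edge path[of j] by (cases "j = 0") (auto simp: y_def)
    moreover have "x k * a k (Suc j) = - y (Suc (Suc j))"
      using that edge path[of "Suc j"] by (auto simp: y_def k_def)
    ultimately show ?thesis
      using ker[of "Suc j"] diag[of "Suc j"] that by (simp add: y_def)
  qed
  have diff: "y (Suc j) - y j = y 1 - y 0" if "j \<le> n" for j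
    using that
  proof (induction j)
    case (Suc j)
    then show ?case using step[of j] by simp
  qed simp
  have prog: "y j = y 0 + real j * (y 1 - y 0)" if "j \<le> Suc n" for j
    using that
  proof (induction j)
    case (Suc j)
    then show ?case using diff[of j] by (simp add: algebra_simps)
  qed simp
  \<comment> \<open>Column 0 is the one equation not yet used; it closes the progression up.\<close>
  have "(\<Sum>l\<le>n. x l * a l 0) = x 0 * a 0 0 + x 1 * a 1 0 + x n * a n 0"
    using \<open>n \<ge> 2\<close> by (intro sum_three_terms) (auto simp: cyclic_adjacent_def intro!: zero)
  then have "2 * x 0 = x 1 / v + v * x n"
    using ker[of 0] edge diag[of 0] by (simp add: algebra_simps)
  then have "2 * (v * x 0) = x 1 + v\<^sup>2 * x n"
    using \<open>v > 0\<close> by (simp add: field_simps power2_eq_square)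
  then have closing: "2 * y 0 = y 1 + v\<^sup>2 * y n"
    using \<open>n \<ge> 2\<close> by (simp add: y_def)
  have last: "y 0 = v\<^sup>2 * y (Suc n)"
    using \<open>v > 0\<close> by (simp add: y_def power2_eq_square)
  \<comment> \<open>By \<open>closing\<close> and \<open>last\<close>, the first difference of
    \<open>y\<close> is \<open>v^2\<close> times the last one, while all differences are
    equal.\<close>
  define \<delta> where "\<delta> = y 1 - y 0"
  have "y (Suc n) = y n + \<delta>"
    using diff[of n] by (simp add: \<delta>_def)
  then have "v\<^sup>2 * y (Suc n) = v\<^sup>2 * y n + v\<^sup>2 * \<delta>"
    by (simp only: distrib_left)
  moreover have "\<delta> = y 0 - v\<^sup>2 * y n"
    using closing by (simp add: \<delta>_def)
  ultimately have "\<delta> = v\<^sup>2 * \<delta>"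
    using last by linarith
  \<comment> \<open>Either \<open>v^2\<close> differs from 1 and the difference is 0 at once, or the
    progression has equal values at \<open>0\<close> and \<open>n + 1\<close>.\<close>
  then have const: "y 1 = y 0"
  proof (cases "v\<^sup>2 = 1")
    case True
    then show ?thesis using last prog[of "Suc n"] by simp
  qed (simp add: \<delta>_def)
  then have all: "y j = y 0" if "j \<le> Suc n" for j
    using prog[OF that] by simp
  \<comment> \<open>A constant \<open>y\<close> satisfies \<open>last\<close> only if
    \<open>v = 1\<close> or \<open>x 0 = 0\<close>; in both cases the weight at index 0 has no
    effect and \<open>x\<close> itself is constant.\<close>
  have "v * ((1 - v\<^sup>2) * x 0) = y 0 - v\<^sup>2 * y 0"
    by (simp add: y_def algebra_simps)
  also have "\<dots> = 0"
    using last unfolding all[OF order_refl] by simp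
  finally have "v\<^sup>2 = 1 \<or> x 0 = 0"
    using \<open>v > 0\<close> by simp
  moreover have "v = 1" if "v\<^sup>2 = 1"
    using that \<open>v > 0\<close> by (simp add: power2_eq_1_iff)
  ultimately have "v * x 0 = x 0"
    by auto
  then show ?thesis
    using all[of i] \<open>i \<le> n\<close> by (cases "i = 0") (auto simp: y_def)
qed

text \<open>Both matrices have entries \<open>-1\<close> along the path from \<open>1\<close> to
  \<open>n\<close>, so \<open>d\<close> is constant there. The edges from \<open>0\<close> to
  \<open>1\<close> and from \<open>n\<close> to \<open>0\<close> then multiply \<open>v\<close> by
  reciprocal factors to give \<open>w\<close>; the product of the two equations is
  \<open>w^2 = v^2\<close>.\<close>

lemma cyclic_normal_form_unique:
  assumes a: "cyclic_normal_form n v a" "v > 0" and b: "cyclic_normal_form n w b" "w > 0"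
    and "n \<ge> 2" and d: "\<And>i. i \<le> n \<Longrightarrow> d i > 0"
    and scale: "\<And>i j. i \<le> n \<Longrightarrow> j \<le> n \<Longrightarrow> b i j = d i * a i j / d j"
  shows "v = w"
proof -
  have const: "d (Suc i) = d 1" if "i < n" for i
    using that
  proof (induction i)
    case (Suc i)
    then have "a (Suc i) (Suc (Suc i)) = - 1" "b (Suc i) (Suc (Suc i)) = - 1"
      using a b by (auto simp: cyclic_normal_form_def)
    then show ?case
      using scale[of "Suc i" "Suc (Suc i)"] d[of "Suc (Suc i)"] Suc by simp
  qed simp
  have dn: "d n = d 1"
    using const[of "n - 1"] \<open>n \<ge> 2\<close> by simp
  have "w = d 0 * v / d 1" "w = d n * v / d 0"
    using scale[of 0 1] scale[of n 0] a b \<open>n \<ge> 2\<close> by (auto simp: cyclic_normal_form_def)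
  then have "w * w = (d 0 * v / d 1) * (d 1 * v / d 0)"
    using dn by simp
  also have "\<dots> = v * v"
    using d[of 0] d[of 1] \<open>n \<ge> 2\<close> by simp
  finally show ?thesis
    using \<open>v > 0\<close> \<open>w > 0\<close> by (metis less_eq_real_def power2_eq_iff_nonneg power2_eq_square)
qed

text \<open>Requiring \<open>-1\<close> along the path fixes the scales of \<open>1\<close> to
  \<open>n\<close> up to a common factor, and the reverse entries follow because opposite entries
  have product 1. The scale at 0 is the remaining freedom, used to make the two entries
  \<open>- v\<close> agree.\<close>

lemma cyclic_normal_form_exists:
  fixes a :: "nat \<Rightarrow> nat \<Rightarrow> real"
  assumes "n \<ge> 2" and diag: "\<And>i. i \<le> n \<Longrightarrow> a i i = 2"
    and zero: "\<And>i j. i \<le> n \<Longrightarrow> j \<le> n \<Longrightarrow> i \<noteq> j \<Longrightarrow> \<not> cyclic_adjacent n i j \<Longrightarrow> a i j = 0"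
    and adj: "\<And>i j. i \<le> n \<Longrightarrow> j \<le> n \<Longrightarrow> i \<noteq> j \<Longrightarrow> cyclic_adjacent n i j \<Longrightarrow> a i j < 0 \<and> a i j * a j i = 1"
  obtains v d where "v > 0" "\<And>i. i \<le> n \<Longrightarrow> d i > 0"
    "cyclic_normal_form n v (\<lambda>i j. d i * a i j / d j)"
proof -
  \<comment> \<open>Chosen so that \<open>e i * a i (Suc i) / e (Suc i) = - 1\<close> for
    \<open>i \<ge> 1\<close>; the empty product normalizes \<open>e 1 = 1\<close>.\<close>
  define e where "e i = (\<Prod>k=1..<i. - a k (Suc k))" for i
  have e_pos: "e i > 0" if "i \<le> n" for i
    unfolding e_def using that adj[of _ "Suc _"] by (intro prod_pos) (auto simp: cyclic_adjacent_def)
  have e_Suc: "e (Suc i) = e i * - a i (Suc i)" if "i \<ge> 1" for i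
    using that by (simp add: e_def)
  have e1: "e 1 = 1"
    by (simp add: e_def)
  have a01: "a 0 1 < 0" "a 0 1 * a 1 0 = 1" and an0: "a n 0 < 0" "a n 0 * a 0 n = 1"
    using \<open>n \<ge> 2\<close> adj[of 0 1] adj[of n 0] by (auto simp: cyclic_adjacent_def)
  \<comment> \<open>The positive solution of \<open>d0 * a 0 1 / e 1 = e n * a n 0 / d0\<close>; the
    radicand is positive because both entries are negative.\<close>
  define d0 where "d0 = sqrt (e n * a n 0 / a 0 1)"
  have ratio: "e n * a n 0 / a 0 1 > 0"
    using e_pos[of n] a01 an0 by (simp add: divide_neg_neg mult_pos_neg)
  then have d0: "d0 > 0" "d0 * d0 = e n * a n 0 / a 0 1"
    by (simp_all only: d0_def real_sqrt_gt_0_iff real_sqrt_mult_self abs_of_pos)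
  define d where "d i = (if i = 0 then d0 else e i)" for i
  define v where "v = - d0 * a 0 1"
  have d_pos: "d i > 0" if "i \<le> n" for i
    using that d0 e_pos by (simp add: d_def)
  have v_pos: "v > 0"
    using d0 a01 by (simp add: v_def mult_pos_neg)
  have v_alt: "v = - e n * a n 0 / d0"
    using d0 a01 by (simp add: v_def field_simps)
  have inv: "a 1 0 = 1 / a 0 1" "a 0 n = 1 / a n 0"
    using a01 an0 by (auto simp: field_simps)
  have edge1: "d 0 * a 0 1 / d 1 = - v" "d 1 * a 1 0 / d 0 = - 1 / v"
    using e1 inv by (simp_all add: d_def v_def)
  have edgen: "d n * a n 0 / d 0 = - v" "d 0 * a 0 n / d n = - 1 / v"
    using \<open>n \<ge> 2\<close> inv by (simp_all add: d_def v_alt)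
  have path: "d i * a i (i + 1) / d (i + 1) = - 1 \<and> d (i + 1) * a (i + 1) i / d i = - 1"
    if "1 \<le> i \<and> i \<le> n - 1" for i
  proof -
    have "a i (Suc i) < 0" "a i (Suc i) * a (Suc i) i = 1" "e i > 0"
      using that adj[of i "Suc i"] e_pos[of i] by (auto simp: cyclic_adjacent_def)
    then show ?thesis
      using that by (simp add: d_def e_Suc field_simps)
  qed
  have "cyclic_normal_form n v (\<lambda>i j. d i * a i j / d j)"
    unfolding cyclic_normal_form_def
  proof (intro conjI allI impI)
    show "d i * a i i / d i = 2" if "i \<le> n" for i
      using diag[OF that] d_pos[OF that] by simp
    show "d i * a i j / d j = 0" if "i \<le> n" "j \<le> n" "i \<noteq> j \<and> \<not> cyclic_adjacent n i j" for i j
      using zero that by simp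
    show "d i * a i (i + 1) / d (i + 1) = - 1" "d (i + 1) * a (i + 1) i / d i = - 1"
      if "1 \<le> i \<and> i \<le> n - 1" for i
      using path[OF that] by blast+
  qed (fact edge1 edgen)+
  show thesis
    by (rule that[of v d]) (fact v_pos, erule d_pos, fact)
qed

text \<open>Applying the functionals \<open>g j\<close> to a linear relation among the
  \<open>f i\<close> gives a left kernel vector of the normalized matrix. Its constancy makes the
  relation a multiple of one with positive coefficients \<open>d i\<close>, which positive
  independence forbids. Keeping \<open>f\<close> and \<open>g\<close> abstract serves roots and
  coroots alike.\<close>

lemma cyclic_normal_form_linear_independence:
  fixes f :: "nat \<Rightarrow> 'b::real_vector" and g :: "nat \<Rightarrow> 'b \<Rightarrow> real"
  assumes "cyclic_normal_form n v (\<lambda>i j. d i * g j (f i) / d j)" "v > 0" "n \<ge> 2"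
    and d: "\<And>i. i \<le> n \<Longrightarrow> d i > 0"
    and lin: "\<And>j. linear (g j)"
    and "inj_on f {0..n}" "positively_independent (f ` {0..n})"
  shows "independent (f ` {0..n})"
proof (rule independent_image_finite)
  fix c i assume c: "(\<Sum>i\<in>{0..n}. c i *\<^sub>R f i) = 0" and i: "i \<in> {0..n}"
  \<comment> \<open>The coefficients of the same relation with respect to the rescaled vectors
    \<open>d i *\<^sub>R f i\<close>.\<close>
  define x where "x i = c i / d i" for i
  have c_eq: "c i = x i * d i" if "i \<le> n" for i
    using d[OF that] by (simp add: x_def)
  have ker: "(\<Sum>i\<le>n. x i * (d i * g j (f i) / d j)) = 0" if "j \<le> n" for j
  proof -
    have "0 = g j (\<Sum>i\<in>{0..n}. c i *\<^sub>R f i)"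
      using c linear_0[OF lin] by simp
    also have "\<dots> = (\<Sum>i\<le>n. c i * g j (f i))"
      by (simp add: linear_sum[OF lin] linear_scale[OF lin] atLeast0AtMost)
    also have "\<dots> = (\<Sum>i\<le>n. x i * (d i * g j (f i) / d j)) * d j"
      using d[OF that] by (auto simp: sum_distrib_right c_eq intro!: sum.cong)
    finally show ?thesis
      using d[OF that] by simp
  qed
  have const: "c i = x 0 * d i" if "i \<le> n" for i
    using cyclic_normal_form_kernel[OF assms(1-3) ker that] c_eq[OF that] by simp
  have "x 0 *\<^sub>R (\<Sum>i\<in>{0..n}. d i *\<^sub>R f i) = (\<Sum>i\<in>{0..n}. c i *\<^sub>R f i)"
    by (auto simp: scaleR_sum_right const intro!: sum.cong)
  moreover have "(\<Sum>i\<in>{0..n}. d i *\<^sub>R f i) \<noteq> 0"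
    using assms(6,7) d by (intro positively_independent_image_sum) auto
  ultimately have "x 0 = 0"
    using c by simp
  then show "c i = 0"
    using i const by simp
qed (use assms(6) in auto)

section \<open>Simple reflections and their products\<close>

lemma realized_root_datumD:
  assumes "realized_root_datum D"
  shows "bilinear (pairing D)"
    and "positively_independent (simple_roots D)"
    and "positively_independent (simple_coroots D)"
    and "span (simple_roots D) = UNIV"
    and "span (simple_coroots D) = UNIV"
    and "bij_betw (coroot D) (simple_roots D) (simple_coroots D)"
    and "\<And>x. x \<in> simple_roots D \<Longrightarrow> pairing D x (coroot D x) = 2"
    and "\<And>x y. x \<in> simple_roots D \<Longrightarrow> y \<in> simple_roots D \<Longrightarrow> x \<noteq> y \<Longrightarrow>
      pairing D x (coroot D y) \<le> 0 \<and>
      (pairing D x (coroot D y) = 0 \<longleftrightarrow> pairing D y (coroot D x) = 0) \<and>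
      pairing D x (coroot D y) * pairing D y (coroot D x) \<in>
        {4 * (cos (pi / real m))\<^sup>2 | m :: nat. m \<ge> 2} \<union> {4..}"
  using assms by (simp_all add: realized_root_datum_def Let_def)

lemma linear_simple_reflection:
  assumes "bilinear (pairing D)"
  shows "linear (simple_reflection D x)"
  unfolding simple_reflection_def using assms
  by (intro linearI) (simp_all add: bilinear_ladd bilinear_lmul algebra_simps)

lemma simple_reflection_root:
  assumes "realized_root_datum D" "x \<in> simple_roots D"
  shows "simple_reflection D x x = - x"
  using realized_root_datumD(7)[OF assms] by (simp add: simple_reflection_def scaleR_2)

lemma simple_reflection_involutive:
  assumes "realized_root_datum D" "x \<in> simple_roots D"
  shows "simple_reflection D x (simple_reflection D x u) = u"
proof -
  have "pairing D (u - pairing D u (coroot D x) *\<^sub>R x) (coroot D x) = - pairing D u (coroot D x)"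
    using realized_root_datumD(1)[OF assms(1)] realized_root_datumD(7)[OF assms]
    by (simp add: bilinear_lsub bilinear_lmul)
  then show ?thesis
    by (simp add: simple_reflection_def)
qed

text \<open>Evaluation at \<open>y\<close> reduces the relation to \<open>q (2 x - p y) = 0\<close>,
  with \<open>p\<close> and \<open>q\<close> the two pairings. As \<open>- p\<close> is nonnegative,
  positive independence keeps the bracket nonzero, so \<open>q = 0\<close> and with it
  \<open>p = 0\<close>.\<close>

lemma commuting_reflections_pairing_zero:
  assumes D: "realized_root_datum D" and xy: "x \<in> simple_roots D" "y \<in> simple_roots D" "x \<noteq> y"
    and comm: "\<And>u. simple_reflection D x (simple_reflection D y u) =
      simple_reflection D y (simple_reflection D x u)"
  shows "pairing D x (coroot D y) = 0"
proof -
  define p q where "p = pairing D x (coroot D y)" and "q = pairing D y (coroot D x)"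
  have pq: "p \<le> 0" "p = 0 \<longleftrightarrow> q = 0"
    using realized_root_datumD(8)[OF D xy] by (auto simp: p_def q_def)
  have lin: "linear (simple_reflection D z)" for z
    using linear_simple_reflection realized_root_datumD(1)[OF D] .
  have xy': "simple_reflection D x y = y - q *\<^sub>R x" "simple_reflection D y x = x - p *\<^sub>R y"
    by (simp_all add: simple_reflection_def p_def q_def)
  have "- (y - q *\<^sub>R x) = - y - q *\<^sub>R (x - p *\<^sub>R y)"
    using comm[of y] simple_reflection_root[OF D] xy
    by (simp add: xy' linear_neg[OF lin] linear_diff[OF lin] linear_scale[OF lin])
  then have "q *\<^sub>R (2 *\<^sub>R x + (- p) *\<^sub>R y) = 0"
    by (simp add: algebra_simps scaleR_2)
  moreover have "2 *\<^sub>R x + (- p) *\<^sub>R y \<noteq> 0"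
    using positively_independent_pair[OF realized_root_datumD(2)[OF D] xy, of 2 "- p"] pq by simp
  ultimately show ?thesis
    using pq by (simp add: p_def)
qed

text \<open>Evaluation at \<open>y\<close> reduces the relation to
  \<open>(p q - 1) (2 y - q x) = 0\<close>, and the second factor is nonzero by positive
  independence because \<open>- q\<close> is nonnegative.\<close>

lemma braided_reflections_pairing:
  assumes D: "realized_root_datum D" and xy: "x \<in> simple_roots D" "y \<in> simple_roots D" "x \<noteq> y"
    and braid: "\<And>u. simple_reflection D x (simple_reflection D y (simple_reflection D x u)) =
      simple_reflection D y (simple_reflection D x (simple_reflection D y u))"
  shows "pairing D x (coroot D y) * pairing D y (coroot D x) = 1"
proof -
  define p q where "p = pairing D x (coroot D y)" and "q = pairing D y (coroot D x)"
  have q: "q \<le> 0"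
    using realized_root_datumD(8)[OF D xy(2,1)] xy(3) by (auto simp: q_def)
  have lin: "linear (simple_reflection D z)" for z
    using linear_simple_reflection realized_root_datumD(1)[OF D] .
  have xy': "simple_reflection D x y = y - q *\<^sub>R x" "simple_reflection D y x = x - p *\<^sub>R y"
    by (simp_all add: simple_reflection_def p_def q_def)
  have "- (y - q *\<^sub>R x) - q *\<^sub>R (- x - p *\<^sub>R (y - q *\<^sub>R x)) = - (- y - q *\<^sub>R (x - p *\<^sub>R y))"
    using braid[of y] simple_reflection_root[OF D] xy
    by (simp add: xy' linear_neg[OF lin] linear_diff[OF lin] linear_scale[OF lin])
  then have "(p * q - 1) *\<^sub>R (2 *\<^sub>R y + (- q) *\<^sub>R x) = 0"
    by (simp add: algebra_simps scaleR_2)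
  moreover have "2 *\<^sub>R y + (- q) *\<^sub>R x \<noteq> 0"
    using positively_independent_pair[OF realized_root_datumD(2)[OF D] xy(2,1), of 2 "- q"] q xy(3)
    by simp
  ultimately show ?thesis
    by (simp add: p_def q_def)
qed

section \<open>Transport of the Coxeter relations to the reflections\<close>

text \<open>The product of \<open>BijGroup UNIV\<close> is composition restricted to
  \<open>Bij UNIV\<close>, so the images under \<open>\<phi>\<close> must first be seen to lie
  there.\<close>

lemma hom_reflection_group_mult:
  assumes \<phi>: "\<phi> \<in> hom W (reflection_group D)" and "x \<in> carrier W" "y \<in> carrier W"
  shows "\<phi> (x \<otimes>\<^bsub>W\<^esub> y) u = \<phi> x (\<phi> y u)"
proof -
  have "carrier (reflection_group D) \<subseteq> Bij UNIV"
    using group.carrier_subgroup_generated_subset[OF group_BijGroup]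
    by (force simp: reflection_group_def BijGroup_def)
  then have "\<phi> x \<in> Bij UNIV" "\<phi> y \<in> Bij UNIV"
    using assms by (auto simp: hom_def)
  then show ?thesis
    using hom_mult[OF assms] by (simp add: reflection_group_def BijGroup_def compose_def)
qed

lemma hom_reflection_group_one:
  assumes "group W" and \<phi>: "\<phi> \<in> hom W (reflection_group D)"
  shows "\<phi> \<one>\<^bsub>W\<^esub> u = u"
proof -
  have "group (reflection_group D)"
    by (simp add: reflection_group_def group.group_subgroup_generated group_BijGroup)
  then have "\<phi> \<one>\<^bsub>W\<^esub> = \<one>\<^bsub>reflection_group D\<^esub>"
    using hom_one[OF \<phi> \<open>group W\<close>] by simp
  then show ?thesis
    by (simp add: reflection_group_def BijGroup_def)
qed

text \<open>The isomorphism carries the relation given by the order of \<open>s i\<close> times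
  \<open>s j\<close> over to the reflections. Since these are involutions, it becomes commutation
  for order 2 and the braid relation for order 3. In the second case the product 1 excludes a zero
  entry, so the sign is strict.\<close>

lemma realized_affine_A_entries:
  assumes A: "affine_A_system n W s"
    and D: "realized_root_datum_of W (s ` {0..n}) \<phi> D"
    and L: "simple_roots_labelled n s \<phi> D \<alpha>"
    and ij: "i \<le> n" "j \<le> n" "i \<noteq> j"
  shows "\<not> cyclic_adjacent n i j \<Longrightarrow> pairing D (\<alpha> i) (coroot D (\<alpha> j)) = 0"
    and "cyclic_adjacent n i j \<Longrightarrow> pairing D (\<alpha> i) (coroot D (\<alpha> j)) < 0 \<and>
      pairing D (\<alpha> i) (coroot D (\<alpha> j)) * pairing D (\<alpha> j) (coroot D (\<alpha> i)) = 1"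
proof -
  define f g where "f = simple_reflection D (\<alpha> i)" and "g = simple_reflection D (\<alpha> j)"
  have W: "group W" "s i \<in> carrier W" "s j \<in> carrier W"
    and ord: "group.ord W (s i \<otimes>\<^bsub>W\<^esub> s j) = (if cyclic_adjacent n i j then 3 else 2)"
    and "inj_on s {0..n}"
    using A ij by (auto simp: affine_A_system_def coxeter_system_def)
  interpret group W by (rule W(1))
  have rd: "realized_root_datum D" and \<phi>: "\<phi> \<in> hom W (reflection_group D)"
    and bij: "bij_betw \<phi> (s ` {0..n}) (simple_reflections D)"
    using D by (auto simp: realized_root_datum_of_def iso_def)
  have roots: "\<alpha> i \<in> simple_roots D" "\<alpha> j \<in> simple_roots D"
    and fg: "\<phi> (s i) = f" "\<phi> (s j) = g"
    using L ij by (auto simp: simple_roots_labelled_def f_def g_def)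
  have "s i \<noteq> s j"
    using \<open>inj_on s {0..n}\<close> ij by (auto dest: inj_onD)
  then have "f \<noteq> g"
    using bij fg ij by (auto simp: bij_betw_def dest!: inj_onD)
  then have ne: "\<alpha> i \<noteq> \<alpha> j"
    by (auto simp: f_def g_def)
  have ff: "f (f u) = u" and gg: "g (g u) = u" for u
    using simple_reflection_involutive[OF rd] roots by (simp_all add: f_def g_def)
  define w where "w = s i \<otimes>\<^bsub>W\<^esub> s j"
  have w: "w \<in> carrier W" "\<And>u. \<phi> w u = f (g u)"
    using W hom_reflection_group_mult[OF \<phi>] fg by (auto simp: w_def)
  have pow: "\<phi> (w [^]\<^bsub>W\<^esub> m) u = ((\<lambda>u. f (g u)) ^^ m) u" for m :: nat and u
    using w hom_reflection_group_one[OF W(1) \<phi>] hom_reflection_group_mult[OF \<phi>]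
    by (induction m arbitrary: u) (simp_all add: funpow_Suc_right del: funpow.simps(2))
  have rel: "((\<lambda>u. f (g u)) ^^ (group.ord W w)) u = u" for u
    using pow[of "group.ord W w" u] w(1) hom_reflection_group_one[OF W(1) \<phi>] pow_ord_eq_1
    by simp
  {
    assume "\<not> cyclic_adjacent n i j"
    then have r: "f (g (f (g u))) = u" for u
      using rel[of u] ord by (simp add: w_def numeral_2_eq_2)
    \<comment> \<open>Inserting \<open>g (f u)\<close> into the relation cancels its last two
      reflections.\<close>
    have "f (g u) = g (f u)" for u
      using r[of "g (f u)"] ff gg by simp
    then show "pairing D (\<alpha> i) (coroot D (\<alpha> j)) = 0"
      using commuting_reflections_pairing_zero[OF rd roots ne] by (simp add: f_def g_def)
  }
  {
    assume "cyclic_adjacent n i j"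
    then have r: "f (g (f (g (f (g u))))) = u" for u
      using rel[of u] ord by (simp add: w_def numeral_3_eq_3)
    \<comment> \<open>Inserting \<open>g (f (g u))\<close> cancels the last three reflections in the
      same way.\<close>
    have "f (g (f u)) = g (f (g u))" for u
      using r[of "g (f (g u))"] ff gg by simp
    then have "pairing D (\<alpha> i) (coroot D (\<alpha> j)) * pairing D (\<alpha> j) (coroot D (\<alpha> i)) = 1"
      using braided_reflections_pairing[OF rd roots ne] by (simp add: f_def g_def)
    moreover from this have "pairing D (\<alpha> i) (coroot D (\<alpha> j)) < 0"
      using realized_root_datumD(8)[OF rd roots ne] by (auto simp: less_le)
    ultimately show "pairing D (\<alpha> i) (coroot D (\<alpha> j)) < 0 \<and>
      pairing D (\<alpha> i) (coroot D (\<alpha> j)) * pairing D (\<alpha> j) (coroot D (\<alpha> i)) = 1"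
      by blast
  }
qed

section \<open>Rescaling\<close>

lemma is_rescaling_pairing:
  assumes "is_rescaling D d D'" "bilinear (pairing D)" "x \<in> simple_roots D" "y \<in> simple_roots D"
  shows "pairing D' (d x *\<^sub>R x) (coroot D' (d y *\<^sub>R y)) =
    d x * pairing D x (coroot D y) / d y"
  using assms by (simp add: is_rescaling_def bilinear_lmul bilinear_rmul divide_inverse)

text \<open>The scale of the root cancels against the inverse scale of the coroot. Hence the
  reflection group is unchanged and the same \<open>\<phi>\<close> serves as identification for
  \<open>D'\<close>.\<close>

lemma is_rescaling_simple_reflection:
  assumes "is_rescaling D d D'" "bilinear (pairing D)" "x \<in> simple_roots D"
  shows "simple_reflection D' (d x *\<^sub>R x) = simple_reflection D x"
proof -
  have "d x > 0" and "pairing D' = pairing D"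
    and "coroot D' (d x *\<^sub>R x) = inverse (d x) *\<^sub>R coroot D x"
    using assms by (auto simp: is_rescaling_def)
  then have "pairing D' u (coroot D' (d x *\<^sub>R x)) * d x = pairing D u (coroot D x)" for u
    using assms(2) by (simp add: bilinear_rmul)
  then show ?thesis
    by (simp add: simple_reflection_def)
qed

text \<open>Signs, zeros and products of opposite entries are invariant under rescaling. Linear
  independence ensures that no two roots and no two coroots are merged, which
  \<open>coroot D'\<close> being a bijection relies on.\<close>

lemma is_rescaling_realized:
  assumes r: "is_rescaling D d D'" and D: "realized_root_datum D"
    and "finite (simple_roots D)"
    and indep: "independent (simple_roots D)" "independent (simple_coroots D)"
  shows "realized_root_datum D'"
proof -
  let ?R = "simple_roots D"
  note Dp = realized_root_datumD[OF D]
  \<comment> \<open>The scale of a coroot as a function of the coroot itself, so that the facts on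
    scaled sets apply to the coroots as well.\<close>
  define c where "c y = inverse (d (inv_into ?R (coroot D) y))" for y
  have d: "d x > 0" if "x \<in> ?R" for x
    using r that by (simp add: is_rescaling_def)
  have coroots: "simple_coroots D = coroot D ` ?R" and inj: "inj_on (coroot D) ?R"
    using Dp(6) by (auto simp: bij_betw_def)
  have c_coroot: "c (coroot D x) = inverse (d x)" if "x \<in> ?R" for x
    using that inj by (simp add: c_def)
  have c: "c y > 0" if "y \<in> simple_coroots D" for y
    using that d by (auto simp: coroots c_coroot)
  have d_nz: "x \<in> ?R \<Longrightarrow> d x \<noteq> 0" and c_nz: "y \<in> simple_coroots D \<Longrightarrow> c y \<noteq> 0" for x y
    using d[of x] c[of y] by auto
  have roots': "simple_roots D' = (\<lambda>x. d x *\<^sub>R x) ` ?R"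
    using r by (simp add: is_rescaling_def)
  have coroots': "simple_coroots D' = (\<lambda>y. c y *\<^sub>R y) ` simple_coroots D"
    using r by (auto simp: is_rescaling_def coroots c_coroot image_image)
  have coroot': "coroot D' (d x *\<^sub>R x) = c (coroot D x) *\<^sub>R coroot D x" if "x \<in> ?R" for x
    using r that by (simp add: is_rescaling_def c_coroot)
  have inj_d: "inj_on (\<lambda>x. d x *\<^sub>R x) ?R" and inj_c: "inj_on (\<lambda>y. c y *\<^sub>R y) (simple_coroots D)"
    by (intro independent_scale_image indep d_nz c_nz; assumption)+
  have bij: "bij_betw (coroot D') (simple_roots D') (simple_coroots D')"
    unfolding bij_betw_def
  proof
    show "inj_on (coroot D') (simple_roots D')"
      unfolding roots'
    proof (rule inj_onI, elim imageE)
      fix u v x y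
      assume *: "coroot D' u = coroot D' v" "u = d x *\<^sub>R x" "v = d y *\<^sub>R y" "x \<in> ?R" "y \<in> ?R"
      then have "coroot D x = coroot D y"
        using coroot' coroots inj_onD[OF inj_c, of "coroot D x" "coroot D y"] by simp
      then show "u = v"
        using * inj_onD[OF inj, of x y] by simp
    qed
    show "coroot D' ` simple_roots D' = simple_coroots D'"
      by (auto simp: roots' coroots' coroots coroot' image_image)
  qed
  have pos: "positively_independent (simple_roots D')"
    unfolding roots' using Dp(2) d inj_d by (rule positively_independent_scale)
  have pos_co: "positively_independent (simple_coroots D')"
    unfolding coroots' using Dp(3) c inj_c by (rule positively_independent_scale)
  have span: "span (simple_roots D') = UNIV"
    unfolding roots' using span_image_scale[OF assms(3), of d] d_nz Dp(4) by simp
  have "finite (simple_coroots D)"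
    using assms(3) coroots by simp
  then have span_co: "span (simple_coroots D') = UNIV"
    unfolding coroots' using span_image_scale[of _ c] c_nz Dp(5) by simp
  have bil: "bilinear (pairing D')"
    using r Dp(1) by (simp add: is_rescaling_def)
  note pair = is_rescaling_pairing[OF r Dp(1)]
  have diag: "pairing D' u (coroot D' u) = 2" if u: "u \<in> simple_roots D'" for u
  proof -
    obtain x where "x \<in> ?R" "u = d x *\<^sub>R x"
      using u by (auto simp: roots')
    then show ?thesis
      using d_nz Dp(7) by (simp add: pair)
  qed
  have entries: "pairing D' u (coroot D' v) \<le> 0"
    "pairing D' u (coroot D' v) = 0 \<longleftrightarrow> pairing D' v (coroot D' u) = 0"
    "pairing D' u (coroot D' v) * pairing D' v (coroot D' u) \<in>
        {4 * (cos (pi / real m))\<^sup>2 | m :: nat. m \<ge> 2} \<union> {4..}"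
    if uv: "u \<in> simple_roots D'" "v \<in> simple_roots D'" "u \<noteq> v" for u v
  proof -
    obtain x y where xy: "x \<in> ?R" "y \<in> ?R" "u = d x *\<^sub>R x" "v = d y *\<^sub>R y" "x \<noteq> y"
      using uv by (auto simp: roots')
    have dd: "d x > 0" "d y > 0"
      using d xy by auto
    have "pairing D' u (coroot D' v) * pairing D' v (coroot D' u) =
        pairing D x (coroot D y) * pairing D y (coroot D x)"
      using dd by (simp add: xy pair)
    moreover have "pairing D' u (coroot D' v) \<le> 0 \<longleftrightarrow> pairing D x (coroot D y) \<le> 0"
      using dd by (simp add: xy pair divide_le_0_iff mult_le_0_iff)
    moreover have "pairing D' u (coroot D' v) = 0 \<longleftrightarrow> pairing D x (coroot D y) = 0"
      "pairing D' v (coroot D' u) = 0 \<longleftrightarrow> pairing D y (coroot D x) = 0"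
      using dd by (simp_all add: xy pair)
    ultimately show "pairing D' u (coroot D' v) \<le> 0"
      "pairing D' u (coroot D' v) = 0 \<longleftrightarrow> pairing D' v (coroot D' u) = 0"
      "pairing D' u (coroot D' v) * pairing D' v (coroot D' u) \<in>
        {4 * (cos (pi / real m))\<^sup>2 | m :: nat. m \<ge> 2} \<union> {4..}"
      using Dp(8)[OF xy(1,2,5)] by simp_all
  qed
  show ?thesis
    unfolding realized_root_datum_def Let_def
    by (intro conjI ballI impI bil pos pos_co span span_co bij diag entries)
qed

text \<open>The new \<open>coroot\<close> takes a scaled root as its argument, so the original root
  has to be recovered from it; linear independence makes the scaling injective.\<close>

lemma is_rescaling_exists:
  assumes "independent (simple_roots D)" "\<And>x. x \<in> simple_roots D \<Longrightarrow> d x > 0"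
  shows "\<exists>D'. is_rescaling D d D'"
proof -
  let ?R = "simple_roots D"
  let ?back = "inv_into ?R (\<lambda>x. d x *\<^sub>R x)"
  have "inj_on (\<lambda>x. d x *\<^sub>R x) ?R"
    using independent_scale_image[OF assms(1)] assms(2) by (metis less_irrefl)
  then have "?back (d x *\<^sub>R x) = x" if "x \<in> ?R" for x
    using that by (simp add: inv_into_f_f[where f = "\<lambda>x. d x *\<^sub>R x"])
  then have "is_rescaling D d
      \<lparr>pairing = pairing D, simple_roots = (\<lambda>x. d x *\<^sub>R x) ` ?R,
       simple_coroots = (\<lambda>x. inverse (d x) *\<^sub>R coroot D x) ` ?R,
       coroot = (\<lambda>u. inverse (d (?back u)) *\<^sub>R coroot D (?back u))\<rparr>"
    using assms(2) by (simp add: is_rescaling_def)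
  then show ?thesis ..
qed

lemma is_rescaling_reflections:
  assumes "is_rescaling D d D'" "bilinear (pairing D)"
  shows "simple_reflections D' = simple_reflections D"
proof -
  have "simple_reflections D' = (\<lambda>x. simple_reflection D' (d x *\<^sub>R x)) ` simple_roots D"
    using assms(1) by (simp add: simple_reflections_def is_rescaling_def image_image)
  then show ?thesis
    using is_rescaling_simple_reflection[OF assms] by (simp add: simple_reflections_def)
qed

section \<open>Existence and uniqueness of the normalized rescaling\<close>

theorem mainTheorem5:
  fixes n :: nat
    and W :: "('g, 'x) monoid_scheme" and s :: "nat \<Rightarrow> 'g"
    and D :: "('v::real_vector, 'w::real_vector) root_datum"
    and \<phi> :: "'g \<Rightarrow> 'v \<Rightarrow> 'v" and \<alpha> :: "nat \<Rightarrow> 'v"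
  assumes "n \<ge> 2"
    and "affine_A_system n W s"
    and "realized_root_datum_of W (s ` {0..n}) \<phi> D"
    and "simple_roots_labelled n s \<phi> D \<alpha>"
  shows "independent (simple_roots D) \<and> independent (simple_coroots D) \<and>
    (\<exists>!v::real. v > 0 \<and>
      (\<exists>d D'. is_rescaling D d D' \<and> realized_root_datum_of W (s ` {0..n}) \<phi> D' \<and>
        (let \<alpha>' = (\<lambda>i. d (\<alpha> i) *\<^sub>R \<alpha> i);
             a = (\<lambda>i j. pairing D' (\<alpha>' i) (coroot D' (\<alpha>' j)))
         in simple_roots_labelled n s \<phi> D' \<alpha>' \<and>
            a 0 1 = - v \<and> a 1 0 = - 1 / v \<and> a n 0 = - v \<and> a 0 n = - 1 / v \<and>
            (\<forall>i. 1 \<le> i \<and> i \<le> n - 1 \<longrightarrow> a i (i + 1) = - 1 \<and> a (i + 1) i = - 1) \<and>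
            (\<forall>i\<le>n. a i i = 2) \<and>
            (\<forall>i\<le>n. \<forall>j\<le>n. i \<noteq> j \<and> \<not> cyclic_adjacent n i j \<longrightarrow> a i j = 0))))"
proof -
  define a where "a i j = pairing D (\<alpha> i) (coroot D (\<alpha> j))" for i j
  have rd: "realized_root_datum D" and bij: "bij_betw \<phi> (s ` {0..n}) (simple_reflections D)"
    using assms(3) by (auto simp: realized_root_datum_of_def)
  note Dp = realized_root_datumD[OF rd]
  have roots: "simple_roots D = \<alpha> ` {0..n}" and \<phi>s: "\<And>i. i \<le> n \<Longrightarrow> \<phi> (s i) = simple_reflection D (\<alpha> i)"
    using assms(4) by (auto simp: simple_roots_labelled_def)
  have root: "\<alpha> i \<in> simple_roots D" if "i \<le> n" for i
    using that by (simp add: roots)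
  have "inj_on s {0..n}"
    using assms(2) by (simp add: affine_A_system_def)
  then have "inj_on (\<phi> \<circ> s) {0..n}"
    using bij by (intro comp_inj_on) (auto simp: bij_betw_def)
  then have inj: "inj_on \<alpha> {0..n}"
    using \<phi>s by (auto simp: inj_on_def)
  have inj_co: "inj_on (\<lambda>i. coroot D (\<alpha> i)) {0..n}"
    and coroots: "simple_coroots D = (\<lambda>i. coroot D (\<alpha> i)) ` {0..n}"
    using comp_inj_on[OF inj, of "coroot D"] Dp(6) by (auto simp: bij_betw_def roots comp_def)
  obtain v e where v: "v > 0" and e: "\<And>i. i \<le> n \<Longrightarrow> e i > 0"
    and nf: "cyclic_normal_form n v (\<lambda>i j. e i * a i j / e j)"
  proof (rule cyclic_normal_form_exists[of n a])
    show "a i i = 2" if "i \<le> n" for i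
      using Dp(7) root[OF that] by (simp add: a_def)
  qed (use assms realized_affine_A_entries[OF assms(2-4)] in \<open>auto simp: a_def\<close>)
  have lin_l: "linear (\<lambda>x. pairing D x y)" and lin_r: "linear (pairing D x)" for x y
    using Dp(1) by (auto simp: bilinear_def)
  have ind: "independent (simple_roots D)"
    unfolding roots
    using cyclic_normal_form_linear_independence[of n v e "\<lambda>j x. pairing D x (coroot D (\<alpha> j))" \<alpha>]
      nf v assms(1) e inj Dp(2) lin_l by (simp add: a_def roots)
  \<comment> \<open>Coroots are rescaled by the inverse factors, and exchanging them with the roots
    transposes the matrix; the parameter becomes \<open>1 / v\<close>.\<close>
  have "cyclic_normal_form n (1 / v) (\<lambda>i j. inverse (e i) * a j i / inverse (e j))"
    using cyclic_normal_form_transpose[OF nf] by (simp add: field_simps)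
  then have ind_co: "independent (simple_coroots D)"
    unfolding coroots
    using cyclic_normal_form_linear_independence[of n "1 / v" "\<lambda>i. inverse (e i)"
        "\<lambda>j. pairing D (\<alpha> j)" "\<lambda>i. coroot D (\<alpha> i)"]
      v assms(1) e inj_co Dp(3) lin_r by (simp add: a_def coroots)
  have entries: "pairing D' (d (\<alpha> i) *\<^sub>R \<alpha> i) (coroot D' (d (\<alpha> j) *\<^sub>R \<alpha> j)) =
      d (\<alpha> i) * a i j / d (\<alpha> j)" if "is_rescaling D d D'" "i \<le> n" "j \<le> n" for d D' i j
    using is_rescaling_pairing[OF that(1) Dp(1)] root that by (simp add: a_def)
  define P where "P d D' w \<longleftrightarrow> is_rescaling D d D' \<and> realized_root_datum_of W (s ` {0..n}) \<phi> D' \<and>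
    simple_roots_labelled n s \<phi> D' (\<lambda>i. d (\<alpha> i) *\<^sub>R \<alpha> i) \<and>
    cyclic_normal_form n w (\<lambda>i j. pairing D' (d (\<alpha> i) *\<^sub>R \<alpha> i) (coroot D' (d (\<alpha> j) *\<^sub>R \<alpha> j)))"
    for d D' w
  have "\<exists>!v. v > 0 \<and> (\<exists>d D'. P d D' v)"
  proof (rule ex1I)
    \<comment> \<open>A rescaling assigns its factors to roots rather than indices; injectivity of
      \<open>\<alpha>\<close> allows the translation.\<close>
    define d where "d x = e (inv_into {0..n} \<alpha> x)" for x
    have d: "d (\<alpha> i) = e i" if "i \<le> n" for i
      using inj that by (simp add: d_def)
    have d_pos: "d x > 0" if "x \<in> simple_roots D" for x
      using that d e by (auto simp: roots)
    obtain D' where r: "is_rescaling D d D'"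
      using is_rescaling_exists[OF ind, of d] d_pos by blast
    have "realized_root_datum D'"
      using is_rescaling_realized[OF r rd _ ind ind_co] by (simp add: roots)
    moreover have refl: "simple_reflections D' = simple_reflections D"
      using is_rescaling_reflections[OF r Dp(1)] .
    ultimately have "realized_root_datum_of W (s ` {0..n}) \<phi> D'"
      using assms(3) by (simp add: realized_root_datum_of_def reflection_group_def)
    moreover have "simple_roots_labelled n s \<phi> D' (\<lambda>i. d (\<alpha> i) *\<^sub>R \<alpha> i)"
      using r is_rescaling_simple_reflection[OF r Dp(1) root] \<phi>s
      by (simp add: simple_roots_labelled_def is_rescaling_def roots image_image)
    moreover have "cyclic_normal_form n v
        (\<lambda>i j. pairing D' (d (\<alpha> i) *\<^sub>R \<alpha> i) (coroot D' (d (\<alpha> j) *\<^sub>R \<alpha> j)))"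
      by (rule cyclic_normal_form_cong[OF assms(1) _ nf]) (simp add: entries[OF r] flip: d)
    ultimately show "v > 0 \<and> (\<exists>d D'. P d D' v)"
      using v r unfolding P_def by blast
  next
    fix w assume "w > 0 \<and> (\<exists>d D'. P d D' w)"
    then obtain d D' where w: "w > 0" and r: "is_rescaling D d D'"
      and b: "cyclic_normal_form n w
        (\<lambda>i j. pairing D' (d (\<alpha> i) *\<^sub>R \<alpha> i) (coroot D' (d (\<alpha> j) *\<^sub>R \<alpha> j)))"
      unfolding P_def by blast
    have d_pos: "d (\<alpha> i) > 0" if "i \<le> n" for i
      using r root[OF that] by (simp add: is_rescaling_def)
    have "v = w"
    \<comment> \<open>Two normalizations of \<open>D\<close> differ from each other by the quotients
      of their scaling factors.\<close>
    proof (rule cyclic_normal_form_unique[OF nf v b w assms(1), of "\<lambda>i. d (\<alpha> i) / e i"])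
      fix i j assume ij: "i \<le> n" "j \<le> n"
      show "pairing D' (d (\<alpha> i) *\<^sub>R \<alpha> i) (coroot D' (d (\<alpha> j) *\<^sub>R \<alpha> j)) =
          d (\<alpha> i) / e i * (e i * a i j / e j) / (d (\<alpha> j) / e j)"
        using entries[OF r ij] e[OF ij(1)] e[OF ij(2)] by simp
    qed (use d_pos e in auto)
    then show "w = v" ..
  qed
  then show ?thesis
    using ind ind_co unfolding P_def cyclic_normal_form_def Let_def by blast
qed

end
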